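(* The crossed cycle-rank-two graph $G_\times$ admits a genuine regular secular phase point $\theta^\star$, i.e. a phase vector carrying a regular scalar secular state with edge-energy vector $r(\theta^\star)$, such that $$\widehat d\cdot r(\theta^\star)<0,$$ whereas the nine-coordinate separator $d$, equivalently its physical pushdown $\widehat d$, is strictly positive on every nonzero singular parity sector: for all $\varepsilon_1,\varepsilon_2\in\{\pm1\}$ and every nonzero $x\in\mathcal P_{\varepsilon_1,\varepsilon_2}\cap\mathbf 1^\perp$, $$\sum_{j=1}^9d_j\Bigl(\sum_{i\in S_j}x_i\Bigr)^2>0,$$ and, equivalently on the physical graph, $\sum_e\widehat d_eA_e^2>0$ for every boundary-compatible singular sector $\sigma$ of $G_\times$ and every nonzero $A\in\ker B_{\sigma,\mathrm{bc}}$. Moreover, $\theta^\star$ is nonsingular (none of its seven phases lies in $\pi\mathbb Z$) and the associated secular eigenvalue is simple (the kernel of the secular matrix $M(\theta^\star)$ is one dimensional).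
   Context: **Graph.** $G_\times$ has internal vertices $v_1,\dots,v_4$ with Kirchhoff conditions and two exterior Dirichlet vertices $b_2,b_4$; edges, in this order, $e_{13}=v_1v_3$, $e_{14}=v_1v_4$, $e_{\mathrm{ext},2}=v_2b_2$, $e_{\mathrm{ext},4}=v_4b_4$, $e_{12}=v_1v_2$, $e_{23}=v_2v_3$, $e_{34}=v_3v_4$. In this order $$\widehat d=\left(\tfrac{117}{25},\tfrac{106}{25},\tfrac35,\tfrac{109}{50},\tfrac{33}{20},-\tfrac{149}{100},-\tfrac{13}{100}\right).$$ **Regular scalar secular state** at $\theta\in(\mathbb R/2\pi\mathbb Z)^7$: real $\phi_v$ ($v=v_1,\dots,v_4$) and real $p_{v,e}$ (for each incidence of an edge with an internal vertex), not all zero, with $\sum_{e\sim v}p_{v,e}=0$ at each $v_i$; for each internal--internal edge $e=vw$, $\theta_e\notin\pi\mathbb Z$, $\phi_w=\phi_v\cos\theta_e+p_{v,e}\sin\theta_e$, $-p_{w,e}=-\phi_v\sin\theta_e+p_{v,e}\cos\theta_e$; for each Dirichlet terminal edge at $v$, $\phi_v\cos\theta_e+p_{v,e}\sin\theta_e=0$. Edge energy: $r_e=\phi_v^2+p_{v,e}^2$. **Secular matrix.** For phases not in $\pi\mathbb Z$, $M(\theta)$ is the real symmetric $4\times4$ matrix indexed by $v_1,\dots,v_4$ obtained by summing, for each internal--internal edge $e=vw$, the block with diagonal entries $-\cot\theta_e$ and off-diagonal entries $\csc\theta_e$ on the coordinates $v,w$, and, for each Dirichlet terminal edge at $v$, the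 term $-\cot\theta_e$ in the $(v,v)$ entry. **Singular sectors of $G_\times$.** Orient edges. A boundary-compatible singular sector $\sigma$ assigns a parity $\sigma_e\in\{\pm1\}$ to each of the five internal--internal edges (and a phase class $\pi\mathbb Z$ to each Dirichlet edge). $B_{\sigma,\mathrm{bc}}$ (rows $v_1,\dots,v_4$, columns edges) has entries $1$ at $v_-$ and $-\sigma_e$ at $v_+$ for an internal--internal edge from $v_-$ to $v_+$, a single entry $1$ at the internal endpoint of a terminal edge, and zeros elsewhere. **Cut-tree (nine-coordinate) data.** Cutting $e_{14}$ (giving terminals $1^-$ at $v_1$, $1^+$ at $v_4$) and $e_{13}$ (giving $2^+$ at $v_1$, $2^-$ at $v_3$), with exterior terminals $0_1$ at $v_2$ and $0_2$ at $v_4$, gives a six-terminal tree. Index $\mathbb R^6$ by $(1^-,1^+,2^-,2^+,0_1,0_2)=(0,1,2,3,4,5)$; $\mathbf 1$ is the all-ones vector and $\mathcal P_{\varepsilon_1,\varepsilon_2}=\{x:x_1=\varepsilon_1x_0,\ x_3=\varepsilon_2x_2\}$. The cut subsets are $S_1=\{3\}$, $S_2=\{0\}$, $S_3=\{4\}$, $S_4=\{2\}$, $S_5=\{1\}$, $S_6=\{5\}$, $S_7=\{3,0\}$, $S_8=\{3,0,4\}$, $S_9=\{1,5\}$, and $$d=\left(\tfrac{49}{25},\tfrac{53}{20},\tfrac35,\tfrac{68}{25},\tfrac{159}{100},\tfrac{109}{50},\tfrac{33}{20},-\tfrac{149}{100},-\tfrac{13}{100}\right).$$ With $\mathcal P(r)=(r_{13},r_{14},r_{\mathrm{ext},2},r_{13},r_{14},r_{\mathrm{ext},4},r_{12},r_{23},r_{34})$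 one has $d\cdot\mathcal P(r)=\widehat d\cdot r$. *)

theory Defs
  imports "HOL-Analysis.Analysis"
begin

section \<open>The crossed cycle-rank-two graph\<close>

datatype ivertex = V1 | V2 | V3 | V4

text \<open>The vertices \<open>B2\<close> and \<open>B4\<close> are the exterior Dirichlet vertices.\<close>

datatype vertex = Inner ivertex | B2 | B4

datatype edge = E13 | E14 | Ext2 | Ext4 | E12 | E23 | E34

lemma UNIV_ivertex: "(UNIV :: ivertex set) = {V1, V2, V3, V4}"
  using ivertex.exhaust by blast

lemma UNIV_edge: "(UNIV :: edge set) = {E13, E14, Ext2, Ext4, E12, E23, E34}"
  using edge.exhaust by blast

instance ivertex :: finite
  by standard (simp add: UNIV_ivertex)

instance edge :: finite
  by standard (simp add: UNIV_edge)

fun ends :: "edge \<Rightarrow> vertex set" where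
  "ends E13 = {Inner V1, Inner V3}"
| "ends E14 = {Inner V1, Inner V4}"
| "ends Ext2 = {Inner V2, B2}"
| "ends Ext4 = {Inner V4, B4}"
| "ends E12 = {Inner V1, Inner V2}"
| "ends E23 = {Inner V2, Inner V3}"
| "ends E34 = {Inner V3, Inner V4}"

definition incident :: "ivertex \<Rightarrow> edge \<Rightarrow> bool" where
  "incident v e \<longleftrightarrow> Inner v \<in> ends e"

definition joins :: "edge \<Rightarrow> ivertex \<Rightarrow> ivertex \<Rightarrow> bool" where
  "joins e v w \<longleftrightarrow> ends e = {Inner v, Inner w}"

definition internal_edge :: "edge \<Rightarrow> bool" where
  "internal_edge e \<longleftrightarrow> ends e \<subseteq> range Inner"

definition dirichlet_edge_at :: "edge \<Rightarrow> ivertex \<Rightarrow> bool" where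
  "dirichlet_edge_at e v \<longleftrightarrow> incident v e \<and> \<not> internal_edge e"

definition dhat :: "real ^ edge" where
  "dhat = (\<chi> e. case e of
     E13 \<Rightarrow> 117/25 | E14 \<Rightarrow> 106/25 | Ext2 \<Rightarrow> 3/5 | Ext4 \<Rightarrow> 109/50
   | E12 \<Rightarrow> 33/20 | E23 \<Rightarrow> - 149/100 | E34 \<Rightarrow> - 13/100)"


section \<open>Regular secular states and the secular matrix\<close>

text \<open>
  A phase point of the torus is given by a real representative \<open>\<theta>\<close>; every condition below is
  \<open>2\<pi>\<close>-periodic in each phase.
\<close>

definition pi_multiples :: "real set" where
  "pi_multiples = {of_int k * pi | k :: int. True}"

text \<open>
  Only the values \<open>p v e\<close> with \<open>incident v e\<close> carry meaning. The relation \<open>joins e\<close> is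
  symmetric, so the transfer equations are required in both directions along an internal edge;
  the two directions are equivalent.
\<close>

definition regular_secular_state ::
    "real ^ edge \<Rightarrow> (ivertex \<Rightarrow> real) \<Rightarrow> (ivertex \<Rightarrow> edge \<Rightarrow> real) \<Rightarrow> bool" where
  "regular_secular_state \<theta> \<phi> p \<longleftrightarrow>
     ((\<exists>v. \<phi> v \<noteq> 0) \<or> (\<exists>v e. incident v e \<and> p v e \<noteq> 0)) \<and>
     (\<forall>v. (\<Sum>e | incident v e. p v e) = 0) \<and>
     (\<forall>e v w. joins e v w \<longrightarrow>
        \<theta> $ e \<notin> pi_multiples \<and>
        \<phi> w = \<phi> v * cos (\<theta> $ e) + p v e * sin (\<theta> $ e) \<and>
        - p w e = - \<phi> v * sin (\<theta> $ e) + p v e * cos (\<theta> $ e)) \<and>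
     (\<forall>e v. dirichlet_edge_at e v \<longrightarrow>
        \<phi> v * cos (\<theta> $ e) + p v e * sin (\<theta> $ e) = 0)"

text \<open>
  For a regular secular state the right-hand side does not depend on the endpoint \<open>v\<close> of \<open>e\<close>,
  and every edge has an internal endpoint, so this determines \<open>r\<close> uniquely.
\<close>

definition edge_energy_vector ::
    "(ivertex \<Rightarrow> real) \<Rightarrow> (ivertex \<Rightarrow> edge \<Rightarrow> real) \<Rightarrow> real ^ edge \<Rightarrow> bool" where
  "edge_energy_vector \<phi> p r \<longleftrightarrow>
     (\<forall>v e. incident v e \<longrightarrow> r $ e = (\<phi> v)\<^sup>2 + (p v e)\<^sup>2)"

definition edge_block :: "real ^ edge \<Rightarrow> edge \<Rightarrow> real ^ ivertex ^ ivertex" where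
  "edge_block \<theta> e = (\<chi> v w.
     if v = w then (if incident v e then - cot (\<theta> $ e) else 0)
     else if joins e v w then 1 / sin (\<theta> $ e) else 0)"

definition secular_matrix :: "real ^ edge \<Rightarrow> real ^ ivertex ^ ivertex" where
  "secular_matrix \<theta> = (\<Sum>e\<in>UNIV. edge_block \<theta> e)"


section \<open>Singular sectors\<close>

text \<open>
  An orientation sends each internal edge to its pair (tail, head). A sector is given by its
  parities on the internal edges; the phase class of a Dirichlet edge is always \<open>\<pi>\<int>\<close>, so the
  values at Dirichlet edges of \<open>ori\<close> and \<open>\<sigma>\<close> are irrelevant.
\<close>

definition orientation :: "(edge \<Rightarrow> ivertex \<times> ivertex) \<Rightarrow> bool" where
  "orientation ori \<longleftrightarrow> (\<forall>e. internal_edge e \<longrightarrow> joins e (fst (ori e)) (snd (ori e)))"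

definition singular_sector :: "(edge \<Rightarrow> real) \<Rightarrow> bool" where
  "singular_sector \<sigma> \<longleftrightarrow> (\<forall>e. internal_edge e \<longrightarrow> \<sigma> e \<in> {1, - 1})"

definition B_bc :: "(edge \<Rightarrow> ivertex \<times> ivertex) \<Rightarrow> (edge \<Rightarrow> real) \<Rightarrow> real ^ edge ^ ivertex" where
  "B_bc ori \<sigma> = (\<chi> v e.
     if internal_edge e then
       (if v = fst (ori e) then 1 else if v = snd (ori e) then - \<sigma> e else 0)
     else (if incident v e then 1 else 0))"


section \<open>Cut-tree data\<close>

text \<open>
  The terminals \<open>1\<^sup>-, 1\<^sup>+, 2\<^sup>-, 2\<^sup>+, 0\<^sub>1, 0\<^sub>2\<close> of the cut tree, in this order: \<open>T1m\<close>, \<open>T1p\<close> are the two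
  ends of the cut edge \<open>E14\<close> (at \<open>V1\<close> and \<open>V4\<close>), \<open>T2m\<close>, \<open>T2p\<close> those of \<open>E13\<close> (at \<open>V3\<close> and \<open>V1\<close>),
  and \<open>X1\<close>, \<open>X2\<close> the exterior terminals at \<open>V2\<close> and \<open>V4\<close>.
\<close>

datatype terminal = T1m | T1p | T2m | T2p | X1 | X2

lemma UNIV_terminal: "(UNIV :: terminal set) = {T1m, T1p, T2m, T2p, X1, X2}"
  using terminal.exhaust by blast

instance terminal :: finite
  by standard (simp add: UNIV_terminal)

text \<open>The following three families are meaningful for indices \<open>1 \<le> j \<le> 9\<close>.\<close>

definition cut_subset :: "nat \<Rightarrow> terminal set" where
  "cut_subset j =
     [{T2p}, {T1m}, {X1}, {T2m}, {T1p}, {X2}, {T2p, T1m}, {T2p, T1m, X1}, {T1p, X2}] ! (j - 1)"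

definition sep_d :: "nat \<Rightarrow> real" where
  "sep_d j =
     [49/25, 53/20, 3/5, 68/25, 159/100, 109/50, 33/20, - 149/100, - 13/100] ! (j - 1)"

definition nine_coords :: "real ^ edge \<Rightarrow> nat \<Rightarrow> real" where
  "nine_coords r j =
     [r $ E13, r $ E14, r $ Ext2, r $ E13, r $ E14, r $ Ext4, r $ E12, r $ E23, r $ E34] ! (j - 1)"

definition parity_space :: "real \<Rightarrow> real \<Rightarrow> (real ^ terminal) set" where
  "parity_space \<epsilon>1 \<epsilon>2 = {x. x $ T1p = \<epsilon>1 * x $ T1m \<and> x $ T2p = \<epsilon>2 * x $ T2m}"

end

theory Submission
  imports Defs
begin

text \<open>
  The two halves of the statement have different sources.

  \<^bold>\<open>Positivity on singular sectors.\<close> In a singular sector the transfer along an edge is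
  \<open>\<plusminus>1\<close>, so the only data are the edge amplitudes, tied by one signed balance at each of the four
  vertices. All signs except those of the two cycles of the graph can be absorbed into the
  amplitudes. What remains is one ternary quadratic form, depending on two cycle signs
  (\<open>sector_form\<close>), and the same form arises from the nine cut coordinates on a parity space,
  where the two signs are the parities of the cut edges. Its four instances are positive definite
  by the leading-minor criterion (\<open>sector_form_pos\<close>), and this settles both the cut-tree version
  and the physical version.

  \<^bold>\<open>Negativity at a regular state.\<close> Along an internal edge \<open>e = vw\<close> the transfer equations say
  that \<open>(\<phi>\<^sub>v, p\<^sub>v\<^sub>e)\<close> is rotated onto \<open>(\<phi>\<^sub>w, -p\<^sub>w\<^sub>e)\<close>. Hence any values, not all zero, with balanced
  \<open>p\<close> at each vertex and equal energies \<open>\<phi>\<^sup>2 + p\<^sup>2\<close> at the two ends of each internal edge define a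
  regular state, whose phases are recovered as rotation angles, as soon as the angles of the
  internal edges avoid \<open>\<pi>\<int>\<close>. This reduces the search for a state
  to a problem about integers, solved by

  \<^item> \<open>\<phi> = (10, 2, 2, 2)\<close>;
  \<^item> \<open>p = 5\<close> and \<open>-11\<close> at the two ends of \<open>e\<^sub>1\<^sub>2\<close> and likewise of \<open>e\<^sub>1\<^sub>3\<close>
    (energy \<open>10\<^sup>2 + 5\<^sup>2 = 2\<^sup>2 + 11\<^sup>2\<close>);
  \<^item> \<open>p = -10\<close> and \<open>14\<close> at the two ends of \<open>e\<^sub>1\<^sub>4\<close> (energy \<open>10\<^sup>2 + 10\<^sup>2 = 2\<^sup>2 + 14\<^sup>2\<close>);
  \<^item> \<open>p = 50\<close> at both ends of \<open>e\<^sub>2\<^sub>3\<close> and \<open>p = -39\<close> at both ends of \<open>e\<^sub>3\<^sub>4\<close>;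
  \<^item> \<open>p = -39\<close> and \<open>p = 25\<close> on the Dirichlet edges at \<open>v\<^sub>2\<close> and \<open>v\<^sub>4\<close>.

  The largest energy sits on \<open>e\<^sub>2\<^sub>3\<close>, where the separator is most negative. The two
  edges with the largest weights meet at \<open>v\<^sub>1\<close>, and there the state escapes the constraint of the
  sectors: an amplitude in a sector enters the balances at both ends of its edge with the same
  magnitude, whereas here the edges at \<open>v\<^sub>1\<close> balance as \<open>5 + 5 - 10 = 0\<close> although they contribute
  \<open>-11\<close>, \<open>-11\<close>, \<open>14\<close> at their far ends.
  The weighted energy is \<open>-187/50\<close>.

  The secular matrix at these phases has rational entries and its kernel is the line through
  \<open>(10, 2, 2, 2)\<close>.
\<close>

section \<open>The ternary form of a singular sector\<close>

text \<open>Sylvester's criterion, by completing squares twice.\<close>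

lemma ternary_form_pos:
  fixes a b c f g h x y z :: real
  assumes a: "a > 0" and ab: "a * b - h\<^sup>2 > 0"
    and det: "a * b * c + 2 * f * g * h - a * f\<^sup>2 - b * g\<^sup>2 - c * h\<^sup>2 > 0"
    and nz: "x \<noteq> 0 \<or> y \<noteq> 0 \<or> z \<noteq> 0"
  shows "a * x\<^sup>2 + b * y\<^sup>2 + c * z\<^sup>2 + 2 * f * y * z + 2 * g * x * z + 2 * h * x * y > 0"
    (is "?Q > 0")
proof -
  define m where "m = a * b - h\<^sup>2"
  define D where "D = a * b * c + 2 * f * g * h - a * f\<^sup>2 - b * g\<^sup>2 - c * h\<^sup>2"
  define u where "u = a * x + h * y + g * z"
  define v where "v = m * y + (a * f - g * h) * z"
  have m: "m > 0" and D: "D > 0"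
    using ab det by (simp_all add: m_def D_def)
  have id: "a * m * ?Q = m * u\<^sup>2 + v\<^sup>2 + a * D * z\<^sup>2"
    unfolding m_def D_def u_def v_def by (simp add: power2_eq_square algebra_simps)
  have "m * u\<^sup>2 + v\<^sup>2 + a * D * z\<^sup>2 > 0"
  proof (rule ccontr)
    have nn: "m * u\<^sup>2 \<ge> 0" "v\<^sup>2 \<ge> 0" "a * D * z\<^sup>2 \<ge> 0"
      using a m D by simp_all
    assume "\<not> ?thesis"
    then have "m * u\<^sup>2 = 0" "v\<^sup>2 = 0" "a * D * z\<^sup>2 = 0"
      using nn by linarith+
    then have "u = 0" "v = 0" "z = 0"
      using a m D by simp_all
    then show False
      using a m nz by (simp add: u_def v_def)
  qed
  then have "0 < a * m * ?Q"
    using id by simp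
  moreover have "0 < a * m"
    using a m by simp
  ultimately show ?thesis
    by (rule zero_less_mult_pos)
qed

text \<open>
  The separator energy of a sector after absorbing signs: \<open>x\<close>, \<open>y\<close>, \<open>z\<close> are the amplitudes of
  \<open>e\<^sub>1\<^sub>3\<close>, \<open>e\<^sub>1\<^sub>4\<close>, \<open>e\<^sub>e\<^sub>x\<^sub>t\<^sub>,\<^sub>2\<close>, the other four amplitudes follow from the vertex balances, and
  \<open>\<epsilon>1\<close>, \<open>\<epsilon>2\<close> are the signs of the two cycles closed by \<open>e\<^sub>1\<^sub>4\<close> and \<open>e\<^sub>1\<^sub>3\<close>.
\<close>

definition sector_form :: "real \<Rightarrow> real \<Rightarrow> real \<Rightarrow> real \<Rightarrow> real \<Rightarrow> real" where
  "sector_form \<epsilon>1 \<epsilon>2 x y z =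
     117/25 * x\<^sup>2 + 106/25 * y\<^sup>2 + 3/5 * z\<^sup>2 + 109/50 * (x + y + z + \<epsilon>2 * x + \<epsilon>1 * y)\<^sup>2
     + 33/20 * (x + y)\<^sup>2 - 149/100 * (x + y + z)\<^sup>2 - 13/100 * (x + y + z + \<epsilon>2 * x)\<^sup>2"

text \<open>
  The coefficients of the expanded form are polynomials in the two signs; the leading minors are
  then twelve positive rational numbers, three for each sign choice.
\<close>

lemma sector_form_pos:
  fixes x y z :: real
  assumes e: "\<epsilon>1 \<in> {1, - 1}" "\<epsilon>2 \<in> {1, - 1}"
    and nz: "x \<noteq> 0 \<or> y \<noteq> 0 \<or> z \<noteq> 0"
  shows "sector_form \<epsilon>1 \<epsilon>2 x y z > 0"
proof -
  define a where "a = 117/25 + 109/50 * (1 + \<epsilon>2)\<^sup>2 + 33/20 - 149/100 - 13/100 * (1 + \<epsilon>2)\<^sup>2"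
  define b where "b = 106/25 + 109/50 * (1 + \<epsilon>1)\<^sup>2 + 33/20 - 149/100 - 13/100"
  define c :: real where "c = 3/5 + 109/50 - 149/100 - 13/100"
  define f where "f = 109/50 * (1 + \<epsilon>1) - 149/100 - 13/100"
  define g where "g = 109/50 * (1 + \<epsilon>2) - 149/100 - 13/100 * (1 + \<epsilon>2)"
  define h where "h = 109/50 * (1 + \<epsilon>1) * (1 + \<epsilon>2) + 33/20 - 149/100 - 13/100 * (1 + \<epsilon>2)"
  have "sector_form \<epsilon>1 \<epsilon>2 x y z
      = a * x\<^sup>2 + b * y\<^sup>2 + c * z\<^sup>2 + 2 * f * y * z + 2 * g * x * z + 2 * h * x * y"
    unfolding sector_form_def a_def b_def c_def f_def g_def h_def
    by (simp add: power2_eq_square field_simps)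
  moreover have "\<dots> > 0"
    by (rule ternary_form_pos[OF _ _ _ nz])
      (use e in \<open>auto simp: a_def b_def c_def f_def g_def h_def power2_eq_square\<close>)
  ultimately show ?thesis
    by simp
qed


section \<open>The cut-tree coordinates\<close>

lemma sum_1_9: "(\<Sum>j=1..9. F j) = F 1 + F 2 + F 3 + F 4 + F 5 + F 6 + F 7 + F 8 + (F 9 :: real)"
  for F :: "nat \<Rightarrow> real"
  by (simp add: eval_nat_numeral)

lemma sum_UNIV_edge:
  "(\<Sum>e\<in>UNIV. F e) = F E13 + F E14 + F Ext2 + F Ext4 + F E12 + F E23 + F E34"
  for F :: "edge \<Rightarrow> 'a::comm_monoid_add"
  by (simp add: UNIV_edge add.assoc)

text \<open>
  On the parity space \<open>x\<close> is determined by its coordinates at \<open>T2p\<close>, \<open>T1m\<close>, \<open>X1\<close>; orthogonality to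
  the constant vector gives the coordinate at \<open>X2\<close>, up to sign the amplitude of \<open>e\<^sub>e\<^sub>x\<^sub>t\<^sub>,\<^sub>4\<close>.
\<close>

lemma cut_form_pos:
  assumes e: "\<epsilon>1 \<in> {1, - 1}" "\<epsilon>2 \<in> {1, - 1}"
    and x: "x \<in> parity_space \<epsilon>1 \<epsilon>2 \<inter> {1}\<^sup>\<bottom>" "x \<noteq> 0"
  shows "(\<Sum>j=1..9. sep_d j * (\<Sum>i\<in>cut_subset j. x $ i)\<^sup>2) > 0"
proof -
  have p1: "x $ T1p = \<epsilon>1 * x $ T1m" and p2: "x $ T2p = \<epsilon>2 * x $ T2m"
    using x by (auto simp: parity_space_def)
  have p2': "x $ T2m = \<epsilon>2 * x $ T2p"
    using p2 e by auto
  have "(\<Sum>i\<in>UNIV. x $ i) = 0"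
    using x by (auto simp: orthogonal_comp_def orthogonal_def inner_vec_def)
  then have s: "x $ X2 = - (x $ T2p + x $ T1m + x $ X1 + \<epsilon>2 * x $ T2p + \<epsilon>1 * x $ T1m)"
    by (simp add: UNIV_terminal p1 p2')
  have nz: "x $ T2p \<noteq> 0 \<or> x $ T1m \<noteq> 0 \<or> x $ X1 \<noteq> 0"
  proof (rule ccontr)
    assume "\<not> ?thesis"
    then have "x $ i = 0" for i
      using p1 p2' s by (cases i) auto
    with x(2) show False
      by (simp add: vec_eq_iff)
  qed
  have "(\<Sum>j=1..9. sep_d j * (\<Sum>i\<in>cut_subset j. x $ i)\<^sup>2)
      = sector_form \<epsilon>1 \<epsilon>2 (x $ T2p) (x $ T1m) (x $ X1)"
    using e unfolding sum_1_9 sep_d_def cut_subset_def sector_form_def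
    by (auto simp: p1 p2' s power2_eq_square algebra_simps)
  with sector_form_pos[OF e nz] show ?thesis
    by simp
qed

lemma pushdown: "(\<Sum>j=1..9. sep_d j * nine_coords r j) = dhat \<bullet> r"
  unfolding sum_1_9 sep_d_def nine_coords_def inner_vec_def sum_UNIV_edge dhat_def
  by (simp add: algebra_simps)


section \<open>Singular sectors on the physical graph\<close>

lemma B_bc_entries:
  assumes "orientation ori" "singular_sector \<sigma>"
  shows "incident v e \<Longrightarrow> (B_bc ori \<sigma> $ v $ e)\<^sup>2 = 1"
    and "\<not> incident v e \<Longrightarrow> B_bc ori \<sigma> $ v $ e = 0"
proof -
  have "internal_edge e \<Longrightarrow> joins e (fst (ori e)) (snd (ori e)) \<and> (\<sigma> e)\<^sup>2 = 1"
    using assms by (auto simp: orientation_def singular_sector_def)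
  then show "incident v e \<Longrightarrow> (B_bc ori \<sigma> $ v $ e)\<^sup>2 = 1"
    and "\<not> incident v e \<Longrightarrow> B_bc ori \<sigma> $ v $ e = 0"
    by (auto simp: B_bc_def incident_def joins_def)
qed

lemma square_of_signed:
  fixes s t u :: real
  assumes "s\<^sup>2 = 1" "s * t = u"
  shows "t\<^sup>2 = u\<^sup>2" "t = s * u"
  using assms by (auto simp: power_mult_distrib power2_eq_1_iff)

text \<open>
  Only the signs of the incidence entries matter. Walking through the vertices in the order
  \<open>v\<^sub>1, v\<^sub>2, v\<^sub>3, v\<^sub>4\<close>, each balance is rescaled by a sign so that it continues the previous one; the
  signs that cannot be absorbed are the coefficients of \<open>x\<close> at \<open>v\<^sub>3\<close> and of \<open>y\<close> at \<open>v\<^sub>4\<close>.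
\<close>

lemma signed_balance_pos:
  fixes A :: "real ^ edge" and b :: "ivertex \<Rightarrow> edge \<Rightarrow> real"
  assumes sgn: "\<And>v e. incident v e \<Longrightarrow> (b v e)\<^sup>2 = 1"
    and v1: "b V1 E13 * A $ E13 + b V1 E14 * A $ E14 + b V1 E12 * A $ E12 = 0"
    and v2: "b V2 Ext2 * A $ Ext2 + b V2 E12 * A $ E12 + b V2 E23 * A $ E23 = 0"
    and v3: "b V3 E13 * A $ E13 + b V3 E23 * A $ E23 + b V3 E34 * A $ E34 = 0"
    and v4: "b V4 E14 * A $ E14 + b V4 Ext4 * A $ Ext4 + b V4 E34 * A $ E34 = 0"
    and nz: "A \<noteq> 0"
  shows "(\<Sum>e\<in>UNIV. dhat $ e * (A $ e)\<^sup>2) > 0"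
proof -
  note [simp] = power_mult_distrib
  have s: "(b V1 E13)\<^sup>2 = 1" "(b V1 E14)\<^sup>2 = 1" "(b V1 E12)\<^sup>2 = 1"
    "(b V2 Ext2)\<^sup>2 = 1" "(b V2 E12)\<^sup>2 = 1" "(b V2 E23)\<^sup>2 = 1"
    "(b V3 E13)\<^sup>2 = 1" "(b V3 E23)\<^sup>2 = 1" "(b V3 E34)\<^sup>2 = 1"
    "(b V4 E14)\<^sup>2 = 1" "(b V4 Ext4)\<^sup>2 = 1" "(b V4 E34)\<^sup>2 = 1"
    by (auto intro!: sgn simp: incident_def)
  define k where "k = b V1 E12 * b V2 E12"
  define l where "l = k * b V2 E23 * b V3 E23"
  define m where "m = l * b V3 E34 * b V4 E34"
  have k: "k\<^sup>2 = 1" and l: "l\<^sup>2 = 1" and m: "m\<^sup>2 = 1"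
    by (simp_all add: k_def l_def m_def s)
  define x where "x = b V1 E13 * A $ E13"
  define y where "y = b V1 E14 * A $ E14"
  define z where "z = - k * b V2 Ext2 * A $ Ext2"
  define e2 where "e2 = l * b V3 E13 * b V1 E13"
  define e1 where "e1 = - m * b V4 E14 * b V1 E14"
  have "e1\<^sup>2 = 1" "e2\<^sup>2 = 1"
    by (simp_all add: e1_def e2_def l m s)
  then have e: "e1 \<in> {1, - 1}" "e2 \<in> {1, - 1}"
    unfolding power2_eq_1_iff by simp_all
  have x2: "(A $ E13)\<^sup>2 = x\<^sup>2" "A $ E13 = b V1 E13 * x"
    by (rule square_of_signed[OF s(1)]; simp add: x_def)+
  have y2: "(A $ E14)\<^sup>2 = y\<^sup>2" "A $ E14 = b V1 E14 * y"
    by (rule square_of_signed[OF s(2)]; simp add: y_def)+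
  have z2: "(A $ Ext2)\<^sup>2 = z\<^sup>2" "A $ Ext2 = - k * b V2 Ext2 * z"
    by (rule square_of_signed[of "- k * b V2 Ext2"]; simp add: z_def k s)+
  have A12: "(A $ E12)\<^sup>2 = (x + y)\<^sup>2" "A $ E12 = - b V1 E12 * (x + y)"
    by (rule square_of_signed[of "- b V1 E12"]; use v1 s(3) in \<open>simp add: x_def y_def\<close>)+
  have A23: "(A $ E23)\<^sup>2 = (x + y + z)\<^sup>2" "A $ E23 = k * b V2 E23 * (x + y + z)"
  proof -
    have "b V2 E23 * A $ E23 = k * (x + y + z)"
      using v2 k s(3-5) unfolding A12(2) z2(2) k_def by algebra
    then have "k * b V2 E23 * A $ E23 = x + y + z"
      using k by algebra
    from square_of_signed[OF _ this] k s(6)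
    show "(A $ E23)\<^sup>2 = (x + y + z)\<^sup>2" "A $ E23 = k * b V2 E23 * (x + y + z)"
      by simp_all
  qed
  have A34: "(A $ E34)\<^sup>2 = (x + y + z + e2 * x)\<^sup>2"
    "A $ E34 = - l * b V3 E34 * (x + y + z + e2 * x)"
  proof -
    have "b V3 E23 * A $ E23 = l * (x + y + z)"
      unfolding A23(2) l_def by simp
    then have "- l * b V3 E34 * A $ E34 = x + y + z + e2 * x"
      using v3 l unfolding x2(2) e2_def by algebra
    from square_of_signed[OF _ this] l s(9)
    show "(A $ E34)\<^sup>2 = (x + y + z + e2 * x)\<^sup>2"
      "A $ E34 = - l * b V3 E34 * (x + y + z + e2 * x)"
      by simp_all
  qed
  have A4: "(A $ Ext4)\<^sup>2 = (x + y + z + e2 * x + e1 * y)\<^sup>2"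
    "A $ Ext4 = m * b V4 Ext4 * (x + y + z + e2 * x + e1 * y)"
  proof -
    have "b V4 E34 * A $ E34 = - m * (x + y + z + e2 * x)"
      unfolding A34(2) m_def by simp
    then have "m * b V4 Ext4 * A $ Ext4 = x + y + z + e2 * x + e1 * y"
      using v4 m unfolding y2(2) e1_def by algebra
    from square_of_signed[OF _ this] m s(11)
    show "(A $ Ext4)\<^sup>2 = (x + y + z + e2 * x + e1 * y)\<^sup>2"
      "A $ Ext4 = m * b V4 Ext4 * (x + y + z + e2 * x + e1 * y)"
      by simp_all
  qed
  have "x \<noteq> 0 \<or> y \<noteq> 0 \<or> z \<noteq> 0"
  proof (rule ccontr)
    assume "\<not> ?thesis"
    then have "A $ e = 0" for e
      using x2(2) y2(2) z2(2) A12(2) A23(2) A34(2) A4(2) by (cases e) auto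
    with nz show False
      by (simp add: vec_eq_iff)
  qed
  from sector_form_pos[OF e this] show ?thesis
    unfolding sum_UNIV_edge sector_form_def x2(1) y2(1) z2(1) A12(1) A23(1) A34(1) A4(1)
    by (simp add: dhat_def)
qed

lemma sector_kernel_pos:
  assumes os: "orientation ori" "singular_sector \<sigma>"
    and A: "B_bc ori \<sigma> *v A = 0" "A \<noteq> 0"
  shows "(\<Sum>e\<in>UNIV. dhat $ e * (A $ e)\<^sup>2) > 0"
proof (rule signed_balance_pos[where b = "\<lambda>v e. B_bc ori \<sigma> $ v $ e"])
  have eq: "(\<Sum>e\<in>UNIV. B_bc ori \<sigma> $ v $ e * A $ e) = 0" for v
    using A(1) by (simp add: vec_eq_iff matrix_vector_mult_def)
  have z: "\<not> Inner v \<in> ends e \<Longrightarrow> B_bc ori \<sigma> $ v $ e = 0" for v e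
    using B_bc_entries(2)[OF os] by (simp add: incident_def)
  show "B_bc ori \<sigma> $ V1 $ E13 * A $ E13 + B_bc ori \<sigma> $ V1 $ E14 * A $ E14
      + B_bc ori \<sigma> $ V1 $ E12 * A $ E12 = 0"
    using eq[of V1] by (simp add: sum_UNIV_edge z)
  show "B_bc ori \<sigma> $ V2 $ Ext2 * A $ Ext2 + B_bc ori \<sigma> $ V2 $ E12 * A $ E12
      + B_bc ori \<sigma> $ V2 $ E23 * A $ E23 = 0"
    using eq[of V2] by (simp add: sum_UNIV_edge z)
  show "B_bc ori \<sigma> $ V3 $ E13 * A $ E13 + B_bc ori \<sigma> $ V3 $ E23 * A $ E23
      + B_bc ori \<sigma> $ V3 $ E34 * A $ E34 = 0"
    using eq[of V3] by (simp add: sum_UNIV_edge z)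
  show "B_bc ori \<sigma> $ V4 $ E14 * A $ E14 + B_bc ori \<sigma> $ V4 $ Ext4 * A $ Ext4
      + B_bc ori \<sigma> $ V4 $ E34 * A $ E34 = 0"
    using eq[of V4] by (simp add: sum_UNIV_edge z)
qed (use B_bc_entries(1)[OF os] A(2) in auto)


section \<open>The regular phase point\<close>

fun star_phi :: "ivertex \<Rightarrow> real" where
  "star_phi V1 = 10"
| "star_phi V2 = 2"
| "star_phi V3 = 2"
| "star_phi V4 = 2"

fun star_p :: "ivertex \<Rightarrow> edge \<Rightarrow> real" where
  "star_p V1 E12 = 5"
| "star_p V1 E13 = 5"
| "star_p V1 E14 = - 10"
| "star_p V2 E12 = - 11"
| "star_p V2 E23 = 50"
| "star_p V2 Ext2 = - 39"
| "star_p V3 E13 = - 11"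
| "star_p V3 E23 = 50"
| "star_p V3 E34 = - 39"
| "star_p V4 E14 = 14"
| "star_p V4 E34 = - 39"
| "star_p V4 Ext4 = 25"
| "star_p _ _ = 0"

definition star_r :: "real ^ edge" where
  "star_r = (\<chi> e. case e of
     E13 \<Rightarrow> 125 | E14 \<Rightarrow> 200 | Ext2 \<Rightarrow> 1525 | Ext4 \<Rightarrow> 629
   | E12 \<Rightarrow> 125 | E23 \<Rightarrow> 2504 | E34 \<Rightarrow> 1525)"

text \<open>
  Solving the transfer equations for the rotation gives
  \<open>cos \<theta>\<^sub>e = (\<phi>\<^sub>v \<phi>\<^sub>w - p\<^sub>v\<^sub>e p\<^sub>w\<^sub>e) / r\<^sub>e\<close> and \<open>sin \<theta>\<^sub>e = (p\<^sub>v\<^sub>e \<phi>\<^sub>w + \<phi>\<^sub>v p\<^sub>w\<^sub>e) / r\<^sub>e\<close>.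
  A Dirichlet edge at \<open>v\<close> fixes only \<open>cot \<theta>\<^sub>e = - p\<^sub>v\<^sub>e / \<phi>\<^sub>v\<close>.
\<close>

definition star_phase :: "real ^ edge \<Rightarrow> bool" where
  "star_phase \<theta> \<longleftrightarrow>
     cos (\<theta> $ E12) = 3/5 \<and> sin (\<theta> $ E12) = - (4/5) \<and>
     cos (\<theta> $ E13) = 3/5 \<and> sin (\<theta> $ E13) = - (4/5) \<and>
     cos (\<theta> $ E14) = 4/5 \<and> sin (\<theta> $ E14) = 3/5 \<and>
     cos (\<theta> $ E23) = - (312/313) \<and> sin (\<theta> $ E23) = 25/313 \<and>
     cos (\<theta> $ E34) = - (1517/1525) \<and> sin (\<theta> $ E34) = - (156/1525) \<and>
     cos (\<theta> $ Ext2) = 39/2 * sin (\<theta> $ Ext2) \<and> sin (\<theta> $ Ext2) \<noteq> 0 \<and>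
     cos (\<theta> $ Ext4) = - (25/2) * sin (\<theta> $ Ext4) \<and> sin (\<theta> $ Ext4) \<noteq> 0"

lemma ex_angle_with_cot: "\<exists>t. cos t = k * sin t \<and> sin t \<noteq> 0" for k :: real
proof (intro exI conjI)
  have c: "cos (arctan k) \<noteq> 0"
    by simp
  then have "sin (arctan k) = k * cos (arctan k)"
    using tan_arctan[of k] by (simp add: tan_def field_simps)
  then show "cos (pi/2 - arctan k) = k * sin (pi/2 - arctan k)"
    by (simp add: cos_diff sin_diff)
  show "sin (pi/2 - arctan k) \<noteq> 0"
    using c by (simp add: sin_diff)
qed

lemma star_phase_exists: "\<exists>\<theta>. star_phase \<theta>"
proof -
  have ang: "\<exists>t. cos t = a \<and> sin t = b" if "a\<^sup>2 + b\<^sup>2 = 1" for a b :: real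
    using sincos_total_2pi[OF that] by metis
  obtain t1 where t1: "cos t1 = 3/5" "sin t1 = - (4/5 :: real)"
    using ang[of "3/5" "- (4/5)"] by (auto simp: power2_eq_square)
  obtain t2 where t2: "cos t2 = 4/5" "sin t2 = (3/5 :: real)"
    using ang[of "4/5" "3/5"] by (auto simp: power2_eq_square)
  obtain t3 where t3: "cos t3 = - (312/313)" "sin t3 = (25/313 :: real)"
    using ang[of "- (312/313)" "25/313"] by (auto simp: power2_eq_square)
  obtain t4 where t4: "cos t4 = - (1517/1525)" "sin t4 = - (156/1525 :: real)"
    using ang[of "- (1517/1525)" "- (156/1525)"] by (auto simp: power2_eq_square)
  obtain t5 where t5: "cos t5 = 39/2 * sin t5" "sin t5 \<noteq> (0 :: real)"
    using ex_angle_with_cot by blast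
  obtain t6 where t6: "cos t6 = - (25/2) * sin t6" "sin t6 \<noteq> (0 :: real)"
    using ex_angle_with_cot by blast
  have "star_phase (\<chi> e. case e of
     E13 \<Rightarrow> t1 | E14 \<Rightarrow> t2 | Ext2 \<Rightarrow> t5 | Ext4 \<Rightarrow> t6 | E12 \<Rightarrow> t1 | E23 \<Rightarrow> t3 | E34 \<Rightarrow> t4)"
    unfolding star_phase_def using t1 t2 t3 t4 t5 t6 by simp
  then show ?thesis
    by blast
qed

lemma not_pi_multiple: "sin t \<noteq> 0 \<Longrightarrow> t \<notin> pi_multiples"
  by (auto simp: pi_multiples_def sin_zero_iff_int2)

lemma star_nonsingular:
  assumes "star_phase \<theta>"
  shows "\<theta> $ e \<notin> pi_multiples"
  by (rule not_pi_multiple, cases e) (use assms in \<open>simp_all add: star_phase_def\<close>)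

lemma incident_sets:
  "{e. incident V1 e} = {E13, E14, E12}"
  "{e. incident V2 e} = {Ext2, E12, E23}"
  "{e. incident V3 e} = {E13, E23, E34}"
  "{e. incident V4 e} = {E14, Ext4, E34}"
proof -
  have "incident V1 e \<longleftrightarrow> e \<in> {E13, E14, E12}" "incident V2 e \<longleftrightarrow> e \<in> {Ext2, E12, E23}"
    "incident V3 e \<longleftrightarrow> e \<in> {E13, E23, E34}" "incident V4 e \<longleftrightarrow> e \<in> {E14, Ext4, E34}" for e
    by (cases e; simp add: incident_def)+
  then show
    "{e. incident V1 e} = {E13, E14, E12}"
    "{e. incident V2 e} = {Ext2, E12, E23}"
    "{e. incident V3 e} = {E13, E23, E34}"
    "{e. incident V4 e} = {E14, Ext4, E34}"
    by auto
qed

lemma star_regular: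
  assumes "star_phase \<theta>"
  shows "regular_secular_state \<theta> star_phi star_p"
  unfolding regular_secular_state_def
proof (intro conjI allI impI)
  have "star_phi V1 \<noteq> 0"
    by simp
  then show "(\<exists>v. star_phi v \<noteq> 0) \<or> (\<exists>v e. incident v e \<and> star_p v e \<noteq> 0)"
    by blast
  show "(\<Sum>e | incident v e. star_p v e) = 0" for v
    by (cases v) (simp_all add: incident_sets)
next
  fix e v w
  assume j: "joins e v w"
  show "\<theta> $ e \<notin> pi_multiples"
    by (rule star_nonsingular[OF assms])
  show "star_phi w = star_phi v * cos (\<theta> $ e) + star_p v e * sin (\<theta> $ e)"
    using j assms by (cases e) (auto simp: joins_def doubleton_eq_iff star_phase_def)
  show "- star_p w e = - star_phi v * sin (\<theta> $ e) + star_p v e * cos (\<theta> $ e)"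
    using j assms by (cases e) (auto simp: joins_def doubleton_eq_iff star_phase_def)
next
  fix e v
  assume "dirichlet_edge_at e v"
  then show "star_phi v * cos (\<theta> $ e) + star_p v e * sin (\<theta> $ e) = 0"
    using assms
    by (cases e) (auto simp: dirichlet_edge_at_def internal_edge_def incident_def star_phase_def)
qed

lemma star_energy: "edge_energy_vector star_phi star_p star_r"
  unfolding edge_energy_vector_def
proof (intro allI impI)
  fix v e
  assume "incident v e"
  then show "star_r $ e = (star_phi v)\<^sup>2 + (star_p v e)\<^sup>2"
    by (cases e; cases v) (simp_all add: incident_def star_r_def)
qed

lemma star_negative: "dhat \<bullet> star_r = - (187/50)"
  by (simp add: inner_vec_def sum_UNIV_edge dhat_def star_r_def)


section \<open>Simplicity of the secular eigenvalue\<close>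

text \<open>
  The Dirichlet phases enter only through their cotangents, so the conditions of \<open>star_phase\<close>
  determine every entry.
\<close>

lemma star_matrix_vector:
  assumes "star_phase \<theta>"
  shows "(secular_matrix \<theta> *v x) $ V1 = 1/6 * x $ V1 - 5/4 * x $ V2 - 5/4 * x $ V3 + 5/3 * x $ V4"
    and "(secular_matrix \<theta> *v x) $ V2 = - (5/4) * x $ V1 - 627/100 * x $ V2 + 313/25 * x $ V3"
    and "(secular_matrix \<theta> *v x) $ V3 =
      - (5/4) * x $ V1 + 313/25 * x $ V2 + (1323/100 - 1517/156) * x $ V3 - 1525/156 * x $ V4"
    and "(secular_matrix \<theta> *v x) $ V4 =
      5/3 * x $ V1 - 1525/156 * x $ V3 + (67/6 - 1517/156) * x $ V4"
proof -
  have cots: "cot (\<theta> $ E12) = - (3/4)" "cot (\<theta> $ E13) = - (3/4)" "cot (\<theta> $ E14) = 4/3"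
    "cot (\<theta> $ E23) = - (312/25)" "cot (\<theta> $ E34) = 1517/156"
    "cot (\<theta> $ Ext2) = 39/2" "cot (\<theta> $ Ext4) = - (25/2)"
    by (simp_all add: cot_def assms[unfolded star_phase_def])
  have sins: "sin (\<theta> $ E12) = - (4/5)" "sin (\<theta> $ E13) = - (4/5)" "sin (\<theta> $ E14) = 3/5"
    "sin (\<theta> $ E23) = 25/313" "sin (\<theta> $ E34) = - (156/1525)"
    by (simp_all add: assms[unfolded star_phase_def])
  note unfold = matrix_vector_mult_def UNIV_ivertex secular_matrix_def sum_UNIV_edge
    edge_block_def joins_def incident_def doubleton_eq_iff cots sins
  show "(secular_matrix \<theta> *v x) $ V1
      = 1/6 * x $ V1 - 5/4 * x $ V2 - 5/4 * x $ V3 + 5/3 * x $ V4"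
    and "(secular_matrix \<theta> *v x) $ V2
      = - (5/4) * x $ V1 - 627/100 * x $ V2 + 313/25 * x $ V3"
    and "(secular_matrix \<theta> *v x) $ V3
      = - (5/4) * x $ V1 + 313/25 * x $ V2 + (1323/100 - 1517/156) * x $ V3 - 1525/156 * x $ V4"
    and "(secular_matrix \<theta> *v x) $ V4
      = 5/3 * x $ V1 - 1525/156 * x $ V3 + (67/6 - 1517/156) * x $ V4"
    by (simp_all add: unfold)
qed

lemma star_simple:
  assumes "star_phase \<theta>"
  shows "dim {x. secular_matrix \<theta> *v x = 0} = 1"
proof -
  define u :: "real ^ ivertex" where "u = (\<chi> v. star_phi v)"
  have "secular_matrix \<theta> *v x = 0 \<longleftrightarrow> (\<exists>c. x = c *\<^sub>R u)" for x
  proof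
    assume "secular_matrix \<theta> *v x = 0"
    then have "(secular_matrix \<theta> *v x) $ v = 0" for v
      by simp
    from this[of V1] this[of V2] this[of V3] this[of V4]
    have "x $ V1 = 5 * x $ V4" "x $ V2 = x $ V4" "x $ V3 = x $ V4"
      unfolding star_matrix_vector[OF assms] by (simp_all add: field_simps)
    then have "x $ v = ((x $ V4 / 2) *\<^sub>R u) $ v" for v
      by (cases v) (simp_all add: u_def)
    then show "\<exists>c. x = c *\<^sub>R u"
      unfolding vec_eq_iff by blast
  next
    assume "\<exists>c. x = c *\<^sub>R u"
    then obtain c where x: "x = c *\<^sub>R u"
      by blast
    have "(secular_matrix \<theta> *v x) $ v = 0" for v
      by (cases v) (simp_all add: star_matrix_vector[OF assms] x u_def)
    then show "secular_matrix \<theta> *v x = 0"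
      by (simp add: vec_eq_iff)
  qed
  then have "{x. secular_matrix \<theta> *v x = 0} = span {u}"
    by (auto simp: span_singleton)
  moreover have "u \<noteq> 0"
    by (auto simp: u_def vec_eq_iff intro!: exI[of _ V1])
  ultimately show ?thesis
    by simp
qed


section \<open>The crossed graph separates regular from singular phases\<close>

theorem theorem7p12:
  shows "(\<exists>\<theta> \<phi> p r.
            regular_secular_state \<theta> \<phi> p \<and> edge_energy_vector \<phi> p r \<and> dhat \<bullet> r < 0 \<and>
            (\<forall>e. \<theta> $ e \<notin> pi_multiples) \<and>
            dim {x. secular_matrix \<theta> *v x = 0} = 1)
       \<and> (\<forall>\<epsilon>1\<in>{1, - 1}. \<forall>\<epsilon>2\<in>{1, - 1}. \<forall>x \<in> parity_space \<epsilon>1 \<epsilon>2 \<inter> {1}\<^sup>\<bottom>. x \<noteq> 0 \<longrightarrow>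
            (\<Sum>j=1..9. sep_d j * (\<Sum>i\<in>cut_subset j. x $ i)\<^sup>2) > 0)
       \<and> (\<forall>r. (\<Sum>j=1..9. sep_d j * nine_coords r j) = dhat \<bullet> r)
       \<and> (\<forall>ori \<sigma>. orientation ori \<and> singular_sector \<sigma> \<longrightarrow>
            (\<forall>A. B_bc ori \<sigma> *v A = 0 \<and> A \<noteq> 0 \<longrightarrow> (\<Sum>e\<in>UNIV. dhat $ e * (A $ e)\<^sup>2) > 0))"
proof -
  obtain \<theta> where \<theta>: "star_phase \<theta>"
    using star_phase_exists by blast
  have neg: "dhat \<bullet> star_r < 0"
    by (simp add: star_negative)
  have "\<exists>\<theta> \<phi> p r.
      regular_secular_state \<theta> \<phi> p \<and> edge_energy_vector \<phi> p r \<and> dhat \<bullet> r < 0 \<and>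
      (\<forall>e. \<theta> $ e \<notin> pi_multiples) \<and> dim {x. secular_matrix \<theta> *v x = 0} = 1"
    using star_regular[OF \<theta>] star_energy neg star_nonsingular[OF \<theta>] star_simple[OF \<theta>] by blast
  then show ?thesis
    using cut_form_pos pushdown sector_kernel_pos by blast
qed

end
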